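(* For every positive integer $n$: $\binom{12n}{3n}\equiv\binom{12n}{4n}\equiv 0 \pmod{6n-1}$; $\binom{30n}{5n}\equiv 0\pmod{(10n-1)(15n-1)}$; $\binom{60n}{6n}\equiv\binom{120n}{40n}\equiv\binom{120n}{45n}\equiv 0\pmod{30n-1}$; $\binom{330n}{88n}\equiv 0\pmod{66n-1}$. *)

theory Defs
  imports "HOL-Number_Theory.Cong"
begin

end

theory Submission
  imports Defs "HOL-Computational_Algebra.Primes"
begin

text \<open>
  By Legendre's formula, \<open>m\<close> divides \<open>N choose k\<close> as soon as \<open>N mod d < k mod d\<close> for every divisor
  \<open>d > 1\<close> of \<open>m\<close>: each prime power \<open>p ^ j\<close> dividing \<open>m\<close> then contributes a factor \<open>p\<close>. In all the
  cases of the theorem \<open>m = M - 1\<close>, \<open>N = c M\<close> and \<open>r k = s M\<close> with small constants \<open>c, r, s\<close>. Modulo a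
  divisor \<open>d\<close> of \<open>m\<close> we have \<open>N \<equiv> c\<close> and \<open>r k \<equiv> s\<close>, and the residue of \<open>k\<close> exceeds \<open>c\<close>
  because no \<open>x \<le> c\<close> solves \<open>r x = s\<close>, at least if \<open>d\<close> is large; the finitely many small \<open>d\<close> are checked
  individually.
\<close>

text \<open>Passing from \<open>n\<close> to \<open>Suc n\<close> adds to the multiplicity the
  number of \<open>j \<ge> 1\<close> with \<open>p ^ j dvd Suc n\<close>, and exactly these
  quotients grow by one. Terms with \<open>p ^ j > n\<close> vanish, so any \<open>L \<ge> n\<close>
  may bound the sum; this lets several factorials share one range.\<close>

lemma legendre_multiplicity_fact:
  fixes p n L :: nat
  assumes "prime p" and "n \<le> L"
  shows "multiplicity p (fact n :: nat) = (\<Sum>j=1..L. n div p ^ j)"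
  using assms(2)
proof (induction n)
  case 0
  then show ?case by simp
next
  case (Suc n)
  have p: "prime_elem p" "p > 1" using assms(1) prime_gt_1_nat by auto
  define v where "v = multiplicity p (Suc n)"
  \<comment> \<open>This bound keeps every exponent \<open>j \<le> v\<close> inside the range of
    summation.\<close>
  have "v < p ^ v" using p by (simp add: power_gt_expt)
  also have "\<dots> \<le> Suc n" unfolding v_def using multiplicity_dvd dvd_imp_le by blast
  finally have vL: "v \<le> L" using Suc.prems by simp
  have iff: "p ^ j dvd Suc n \<longleftrightarrow> j \<le> v" for j
    unfolding v_def using p by (intro power_dvd_iff_le_multiplicity) auto
  have "multiplicity p (fact (Suc n) :: nat) = v + multiplicity p (fact n :: nat)"
    unfolding fact_Suc v_def
    using p by (simp add: prime_elem_multiplicity_mult_distrib del: of_nat_Suc mult_Suc)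
  also have "v = card {j \<in> {1..L}. p ^ j dvd Suc n}"
  proof -
    have "{j \<in> {1..L}. p ^ j dvd Suc n} = {1..v}" unfolding iff using vL by auto
    then show ?thesis by simp
  qed
  also have "\<dots> = (\<Sum>j=1..L. if p ^ j dvd Suc n then 1 else 0)"
    by (simp flip: sum.inter_filter)
  also have "multiplicity p (fact n :: nat) = (\<Sum>j=1..L. n div p ^ j)"
    using Suc by simp
  also have "(\<Sum>j=1..L. if p ^ j dvd Suc n then 1 else 0) + (\<Sum>j=1..L. n div p ^ j)
      = (\<Sum>j=1..L. Suc n div p ^ j)"
    unfolding sum.distrib[symmetric] by (intro sum.cong) (auto simp: div_Suc dvd_eq_mod_eq_0)
  finally show ?case .
qed

text \<open>The remainders of \<open>k\<close> and \<open>N - k\<close> either stay below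
  \<open>d\<close> in sum, and then add up to \<open>N mod d\<close>, or carry into the quotient;
  \<open>N mod d < k mod d\<close> rules out the former.\<close>

lemma div_add_div_diff_le:
  fixes N k d :: nat
  assumes "k \<le> N" and "d > 0"
  shows "k div d + (N - k) div d + (if N mod d < k mod d then 1 else 0) \<le> N div d"
proof -
  let ?e = "k mod d + (N - k) mod d"
  have "N div d = k div d + (N - k) div d + ?e div d"
    using div_add1_eq[of k "N - k" d] assms(1) by simp
  moreover have "?e div d \<ge> 1" if "N mod d < k mod d"
  proof (rule ccontr)
    assume "\<not> ?e div d \<ge> 1"
    then have "?e < d" using assms(2) by (simp add: div_eq_0_iff not_le)
    moreover have "N mod d = ?e mod d" using assms(1) by (simp add: mod_add_eq)
    ultimately show False using that by simp
  qed
  ultimately show ?thesis by auto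
qed

lemma prime_power_dvd_binomial:
  fixes p e N k :: nat
  assumes "prime p" and "k \<le> N"
    and carry: "\<And>j. 1 \<le> j \<Longrightarrow> j \<le> e \<Longrightarrow> N mod p ^ j < k mod p ^ j"
  shows "p ^ e dvd N choose k"
proof -
  have p: "prime_elem p" "p > 0" using assms(1) prime_gt_0_nat by auto
  \<comment> \<open>\<open>N\<close> makes the range long enough for all three factorials,
    \<open>e\<close> makes it contain every level with an assumed carry.\<close>
  define L where "L = max N e"
  let ?S = "\<lambda>n. \<Sum>j=1..L. n div p ^ j"
  have leg: "multiplicity p (fact n :: nat) = ?S n" if "n \<le> N" for n
    using legendre_multiplicity_fact[OF assms(1), of n L] that by (simp add: L_def)
  have "e = card {j \<in> {1..L}. j \<le> e}"
  proof -
    have "{j \<in> {1..L}. j \<le> e} = {1..e}" by (auto simp: L_def)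
    then show ?thesis by simp
  qed
  also have "\<dots> = (\<Sum>j=1..L. if j \<le> e then 1 else 0)"
    by (simp flip: sum.inter_filter)
  finally have "?S k + ?S (N - k) + e
      = (\<Sum>j=1..L. k div p ^ j + (N - k) div p ^ j + (if j \<le> e then 1 else 0))"
    by (simp add: sum.distrib)
  also have "\<dots> \<le> ?S N"
  proof (rule sum_mono)
    fix j assume "j \<in> {1..L}"
    then show "k div p ^ j + (N - k) div p ^ j + (if j \<le> e then 1 else 0) \<le> N div p ^ j"
      using div_add_div_diff_le[OF assms(2), of "p ^ j"] carry[of j] p
      by (auto split: if_splits)
  qed
  also have "?S N = multiplicity p (fact k * fact (N - k) * (N choose k))"
    using leg[of N] binomial_fact_lemma[OF assms(2)] by simp
  also have "\<dots> = ?S k + ?S (N - k) + multiplicity p (N choose k)"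
    using leg[of k] leg[of "N - k"] assms(2) p
    by (simp add: prime_elem_multiplicity_mult_distrib)
  finally show ?thesis by (simp add: multiplicity_dvd')
qed

lemma dvd_binomial_if_mod_less:
  fixes m N k :: nat
  assumes "m > 0"
    and carry: "\<And>d. d > 1 \<Longrightarrow> d dvd m \<Longrightarrow> N mod d < k mod d"
  shows "m dvd N choose k"
proof (cases "k \<le> N")
  case True
  show ?thesis
  proof (rule multiplicity_le_imp_dvd)
    show "m \<noteq> 0" using assms(1) by simp
    fix p :: nat assume p: "prime p"
    have "p ^ multiplicity p m dvd N choose k"
    proof (rule prime_power_dvd_binomial[OF p True])
      fix j assume j: "1 \<le> j" "j \<le> multiplicity p m"
      show "N mod p ^ j < k mod p ^ j"
        using j prime_gt_1_nat[OF p] by (intro carry one_less_power multiplicity_dvd') auto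
    qed
    then show "multiplicity p m \<le> multiplicity p (N choose k)"
      using p True by (intro multiplicity_geI) auto
  qed
qed (simp add: binomial_eq_0)

text \<open>If \<open>k mod d\<close> were at most \<open>c\<close>, then
  \<open>r * (k mod d)\<close> and \<open>s\<close> would both lie below \<open>d\<close>, so their
  congruence would be an equality, which the last hypothesis excludes.\<close>

lemma mod_less_mod_if_cong:
  fixes N k d c r s :: nat
  assumes "[N = c] (mod d)" and "[r * k = s] (mod d)"
    and "s < d" and "r * c < d" and "\<And>x. x \<le> c \<Longrightarrow> r * x \<noteq> s"
  shows "N mod d < k mod d"
proof (rule ccontr)
  assume "\<not> N mod d < k mod d"
  then have "k mod d \<le> c mod d"
    using assms(1) by (simp add: cong_def)
  then have le: "k mod d \<le> c"
    using mod_less_eq_dividend[of c d] by linarith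
  then have "r * (k mod d) < d"
    using assms(4) by (meson le_less_trans mult_le_mono2)
  then have "r * (k mod d) = s"
    using assms(2,3) by (metis cong_def mod_less mod_mult_right_eq)
  then show False using assms(5) le by blast
qed

text \<open>Beyond \<open>max s (r * c)\<close> the size argument of
  \<open>mod_less_mod_if_cong\<close> applies. Up to it only \<open>t = n mod d\<close> matters, and
  \<open>a * t mod d = 1\<close> encodes \<open>d dvd a * n - 1\<close>, so \<open>small\<close> is
  a finite check independent of \<open>n\<close>.\<close>

lemma pred_dvd_binomial:
  fixes a b e n c r s :: nat
  assumes "n > 0" and "a > 1" and "b = c * a" and "r * e = s * a"
    and no_sol: "\<forall>x\<in>{..c}. r * x \<noteq> s"
    and small: "\<forall>d\<in>{..max s (r * c)}. \<forall>t\<in>{..<d}. 1 < d \<and> a * t mod d = 1 \<longrightarrow> b * t mod d < e * t mod d"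
  shows "a * n - 1 dvd (b * n) choose (e * n)"
proof (rule dvd_binomial_if_mod_less)
  have "1 * 1 < a * n" using assms(1,2) by (intro mult_less_le_imp_less) auto
  then have an: "a * n > 1" by simp
  then show "a * n - 1 > 0" by simp
  fix d :: nat assume d: "d > 1" "d dvd a * n - 1"
  then have M: "[a * n = 1] (mod d)"
    using an cong_altdef_nat[of 1 "a * n" d] by (metis less_imp_le)
  show "b * n mod d < e * n mod d"
  proof (cases "d \<le> max s (r * c)")
    case True
    have "a * (n mod d) mod d = 1" using M d by (simp add: cong_def mod_mult_right_eq)
    then have "b * (n mod d) mod d < e * (n mod d) mod d" using small True d by auto
    then show ?thesis by (simp add: mod_mult_right_eq)
  next
    case False
    show ?thesis
    proof (rule mod_less_mod_if_cong[where c = c and r = r and s = s])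
      show "[b * n = c] (mod d)"
        using cong_scalar_left[OF M, of c] assms(3) by (simp add: mult.assoc)
      show "[r * (e * n) = s] (mod d)"
        using cong_scalar_left[OF M, of s] assms(4) by (simp flip: mult.assoc)
    qed (use False no_sol in auto)
  qed
qed

theorem theorem2p3:
  fixes n :: nat
  assumes "n > 0"
  shows "([(12 * n) choose (3 * n) = (12 * n) choose (4 * n)] (mod (6 * n - 1)) \<and>
          [(12 * n) choose (4 * n) = 0] (mod (6 * n - 1))) \<and>
         [(30 * n) choose (5 * n) = 0] (mod ((10 * n - 1) * (15 * n - 1))) \<and>
         ([(60 * n) choose (6 * n) = (120 * n) choose (40 * n)] (mod (30 * n - 1)) \<and>
          [(120 * n) choose (40 * n) = (120 * n) choose (45 * n)] (mod (30 * n - 1)) \<and>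
          [(120 * n) choose (45 * n) = 0] (mod (30 * n - 1))) \<and>
         [(330 * n) choose (88 * n) = 0] (mod (66 * n - 1))"
proof -
  \<comment> \<open>In each instance \<open>c\<close> is \<open>b / a\<close>, and
    \<open>s / r\<close> is \<open>e / a\<close> in lowest terms; since \<open>r > 1\<close>, no
    integer solves \<open>r * x = s\<close>. The divisors left to evaluation are at most 15.\<close>
  have d12_3_6: "6 * n - 1 dvd (12 * n) choose (3 * n)"
    by (rule pred_dvd_binomial[where c = 2 and r = 2 and s = 1, OF assms])
      (simp_all add: atMost_nat_numeral lessThan_nat_numeral atMost_Suc lessThan_Suc)
  have d12_4_6: "6 * n - 1 dvd (12 * n) choose (4 * n)"
    by (rule pred_dvd_binomial[where c = 2 and r = 3 and s = 2, OF assms])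
      (simp_all add: atMost_nat_numeral lessThan_nat_numeral atMost_Suc lessThan_Suc)
  have d30_5_10: "10 * n - 1 dvd (30 * n) choose (5 * n)"
    by (rule pred_dvd_binomial[where c = 3 and r = 2 and s = 1, OF assms])
      (simp_all add: atMost_nat_numeral lessThan_nat_numeral atMost_Suc lessThan_Suc)
  have d30_5_15: "15 * n - 1 dvd (30 * n) choose (5 * n)"
    by (rule pred_dvd_binomial[where c = 2 and r = 3 and s = 1, OF assms])
      (simp_all add: atMost_nat_numeral lessThan_nat_numeral atMost_Suc lessThan_Suc)
  have d60_6_30: "30 * n - 1 dvd (60 * n) choose (6 * n)"
    by (rule pred_dvd_binomial[where c = 2 and r = 5 and s = 1, OF assms])
      (simp_all add: atMost_nat_numeral lessThan_nat_numeral atMost_Suc lessThan_Suc)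
  have d120_40_30: "30 * n - 1 dvd (120 * n) choose (40 * n)"
    by (rule pred_dvd_binomial[where c = 4 and r = 3 and s = 4, OF assms])
      (simp_all add: atMost_nat_numeral lessThan_nat_numeral atMost_Suc lessThan_Suc)
  have d120_45_30: "30 * n - 1 dvd (120 * n) choose (45 * n)"
    by (rule pred_dvd_binomial[where c = 4 and r = 2 and s = 3, OF assms])
      (simp_all add: atMost_nat_numeral lessThan_nat_numeral atMost_Suc lessThan_Suc)
  have d330_88_66: "66 * n - 1 dvd (330 * n) choose (88 * n)"
    by (rule pred_dvd_binomial[where c = 5 and r = 3 and s = 4, OF assms])
      (simp_all add: atMost_nat_numeral lessThan_nat_numeral atMost_Suc lessThan_Suc)
  have "coprime (10 * n - 1) (15 * n - 1)"
  proof (rule coprimeI)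
    fix d assume "d dvd 10 * n - 1" "d dvd 15 * n - 1"
    \<comment> \<open>The coefficients cancel \<open>30 * n\<close>, leaving
      \<open>(30 * n - 2) - (30 * n - 3)\<close>.\<close>
    then have "d dvd 2 * (15 * n - 1) - 3 * (10 * n - 1)"
      by (meson dvd_diff_nat dvd_mult)
    also have "2 * (15 * n - 1) - 3 * (10 * n - 1) = 1" using assms by simp
    finally show "is_unit d" .
  qed
  with d30_5_10 d30_5_15 have d30_5: "(10 * n - 1) * (15 * n - 1) dvd (30 * n) choose (5 * n)"
    by (rule divides_mult)
  \<comment> \<open>Every congruence claimed relates two multiples of its modulus, one of them
    possibly 0.\<close>
  have cong: "[x = y] (mod m)" if "m dvd x" "m dvd y" for x y m :: nat
    using that by (metis cong_0_iff cong_sym cong_trans)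
  show ?thesis
    by (intro conjI cong dvd_0_right d12_3_6 d12_4_6 d30_5 d60_6_30 d120_40_30 d120_45_30 d330_88_66)
qed

end
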